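(* For any integer $\gamma \geq 0$, as a set-operad, the underlying set of $\mathsf{Trias}_\gamma$ is the set of all words on the alphabet $\{0, 1, \dots, \gamma\}$ containing at least one occurrence of $0$.
   Context: Write $[\gamma] = \{1, \dots, \gamma\}$. A set-operad is a nonsymmetric operad in sets, described by partial compositions $\circ_i$ and a unit. Let $\mathcal{M}_\gamma$ be the monoid on $\{0\} \cup [\gamma]$ with product $\max$, and let $\mathsf{T}\mathcal{M}_\gamma$ be the set-operad whose elements of arity $n \ge 1$ are all words of length $n$ on $\{0\} \cup [\gamma]$, with partial compositions $u \circ_i v := u_1 \dots u_{i-1}\,\max(u_i, v_1) \dots \max(u_i, v_m)\, u_{i+1} \dots u_n$ (for words $u,v$ of lengths $n,m$) and unit the one-letter word $0$. $\mathsf{Trias}_\gamma$ is the suboperad of $\mathsf{T}\mathcal{M}_\gamma$ generated by the two-letter words $\{0a, 00, a0 : a \in [\gamma]\}$, i.e. the smallest set of words containing these and the unit $0$ and closed under all partial compositions. *)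

theory Defs
  imports Main
begin

text \<open>
  Nonsymmetric set-operads in partial-composition form. The graded collection of sets is encoded
  as one set of elements with an arity function; \<open>pcomp P x i y\<close> is the partial
  composition of \<open>y\<close> into the \<open>i\<close>-th input of \<open>x\<close>, with
  inputs numbered from 1. Its value is only meaningful for \<open>1 \<le> i \<le> arity P x\<close>.
\<close>

record 'a set_operad =
  elems :: "'a set"
  arity :: "'a \<Rightarrow> nat"
  pcomp :: "'a \<Rightarrow> nat \<Rightarrow> 'a \<Rightarrow> 'a"
  opunit :: "'a"

locale ns_set_operad =
  fixes P :: "'a set_operad"
  assumes arity_pos: "x \<in> elems P \<Longrightarrow> 1 \<le> arity P x"
    and unit_closed: "opunit P \<in> elems P"
    and arity_unit: "arity P (opunit P) = 1"
    and pcomp_closed: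
      "x \<in> elems P \<Longrightarrow> y \<in> elems P \<Longrightarrow> i \<in> {1..arity P x} \<Longrightarrow> pcomp P x i y \<in> elems P"
    and arity_pcomp:
      "x \<in> elems P \<Longrightarrow> y \<in> elems P \<Longrightarrow> i \<in> {1..arity P x} \<Longrightarrow>
        arity P (pcomp P x i y) = arity P x + arity P y - 1"
    and pcomp_seq:
      "x \<in> elems P \<Longrightarrow> y \<in> elems P \<Longrightarrow> z \<in> elems P \<Longrightarrow>
        i \<in> {1..arity P x} \<Longrightarrow> j \<in> {1..arity P y} \<Longrightarrow>
        pcomp P (pcomp P x i y) (i + j - 1) z = pcomp P x i (pcomp P y j z)"
    and pcomp_par:
      "x \<in> elems P \<Longrightarrow> y \<in> elems P \<Longrightarrow> z \<in> elems P \<Longrightarrow>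
        i \<in> {1..arity P x} \<Longrightarrow> j \<in> {1..arity P x} \<Longrightarrow> i < j \<Longrightarrow>
        pcomp P (pcomp P x i y) (j + arity P y - 1) z = pcomp P (pcomp P x j z) i y"
    and unit_left: "x \<in> elems P \<Longrightarrow> pcomp P (opunit P) 1 x = x"
    and unit_right: "x \<in> elems P \<Longrightarrow> i \<in> {1..arity P x} \<Longrightarrow> pcomp P x i (opunit P) = x"

definition is_suboperad :: "'a set_operad \<Rightarrow> 'a set \<Rightarrow> bool" where
  "is_suboperad P H \<longleftrightarrow>
     H \<subseteq> elems P \<and> opunit P \<in> H \<and>
     (\<forall>x\<in>H. \<forall>y\<in>H. \<forall>i\<in>{1..arity P x}. pcomp P x i y \<in> H)"

definition generated_suboperad :: "'a set_operad \<Rightarrow> 'a set \<Rightarrow> 'a set_operad" where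
  "generated_suboperad P G = P\<lparr>elems := \<Inter>{H. is_suboperad P H \<and> G \<subseteq> H}\<rparr>"

definition word_comp :: "nat list \<Rightarrow> nat \<Rightarrow> nat list \<Rightarrow> nat list" where
  "word_comp u i v = take (i - 1) u @ map (max (u ! (i - 1))) v @ drop i u"

definition TM :: "nat \<Rightarrow> nat list set_operad" where
  "TM \<gamma> = \<lparr>elems = {w. w \<noteq> [] \<and> set w \<subseteq> {0..\<gamma>}}, arity = length,
           pcomp = word_comp, opunit = [0]\<rparr>"

text \<open>
  The word \<open>00\<close> does not depend on a letter \<open>a \<in> {1..\<gamma>}\<close>, so it is a generator also for
  \<open>\<gamma> = 0\<close>, where it is the only one.
\<close>

definition Trias_gens :: "nat \<Rightarrow> nat list set" where
  "Trias_gens \<gamma> = {[0, 0]} \<union> (\<Union>a\<in>{1..\<gamma>}. {[0, a], [a, 0]})"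

definition Trias :: "nat \<Rightarrow> nat list set_operad" where
  "Trias \<gamma> = generated_suboperad (TM \<gamma>) (Trias_gens \<gamma>)"

lemma length_word_comp:
  "1 \<le> i \<Longrightarrow> i \<le> length u \<Longrightarrow> length (word_comp u i v) = length u + length v - 1"
  by (auto simp: word_comp_def)

lemma word_comp_split:
  "word_comp (p @ a # q) (Suc (length p)) v = p @ map (max a) v @ q"
  by (simp add: word_comp_def)

lemma split_at:
  assumes "i \<in> {1..length u}"
  obtains p a q where "u = p @ a # q" "i = Suc (length p)"
proof
  show "u = take (i - 1) u @ u ! (i - 1) # drop (Suc (i - 1)) u"
    using assms by (intro id_take_nth_drop) auto
  show "i = Suc (length (take (i - 1) u))" using assms by auto
qed

lemma word_comp_seq:
  assumes "i \<in> {1..length u}" "j \<in> {1..length v}"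
  shows "word_comp (word_comp u i v) (i + j - 1) w = word_comp u i (word_comp v j w)"
proof -
  obtain p a q where u: "u = p @ a # q" "i = Suc (length p)" using assms(1) by (rule split_at)
  obtain r b s where v: "v = r @ b # s" "j = Suc (length r)" using assms(2) by (rule split_at)
  have "word_comp (word_comp u i v) (i + j - 1) w
      = word_comp ((p @ map (max a) r) @ max a b # (map (max a) s @ q))
          (Suc (length (p @ map (max a) r))) w"
    by (simp add: u v word_comp_split)
  also have "\<dots> = word_comp u i (word_comp v j w)"
    by (simp only: word_comp_split u v) (simp add: max.assoc)
  finally show ?thesis .
qed

lemma word_comp_par:
  assumes "i \<in> {1..length u}" "j \<in> {1..length u}" "i < j"
  shows "word_comp (word_comp u i v) (j + length v - 1) w = word_comp (word_comp u j w) i v"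
proof -
  obtain p a q where u: "u = p @ a # q" "i = Suc (length p)" using assms(1) by (rule split_at)
  have "j - i \<in> {1..length q}" using assms u by auto
  then obtain r b s where q: "q = r @ b # s" "j - i = Suc (length r)" by (rule split_at)
  have j: "j = Suc (length (p @ a # r))" using q u assms(3) by simp
  have k: "j + length v - 1 = Suc (length (p @ map (max a) v @ r))" using j by simp
  have "word_comp (word_comp u i v) (j + length v - 1) w
      = word_comp ((p @ map (max a) v @ r) @ b # s) (Suc (length (p @ map (max a) v @ r))) w"
    unfolding k u(2) by (simp add: u(1) q(1) word_comp_split)
  also have "\<dots> = p @ map (max a) v @ r @ map (max b) w @ s"
    unfolding word_comp_split by simp
  also have "\<dots> = word_comp (p @ a # (r @ map (max b) w @ s)) i v"
    unfolding u(2) word_comp_split by simp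
  also have "p @ a # (r @ map (max b) w @ s) = word_comp ((p @ a # r) @ b # s) j w"
    by (simp only: j word_comp_split) simp
  also have "(p @ a # r) @ b # s = u" by (simp add: u q)
  finally show ?thesis .
qed

lemma set_word_comp:
  assumes "i \<in> {1..length u}" "set u \<subseteq> {0..\<gamma>}" "set v \<subseteq> {0..\<gamma>}"
  shows "set (word_comp u i v) \<subseteq> {0..\<gamma>}"
proof -
  obtain p a q where u: "u = p @ a # q" "i = Suc (length p)" using assms(1) by (rule split_at)
  show ?thesis using assms(2,3) by (auto simp: u word_comp_split)
qed

lemma word_comp_unit_right: "i \<in> {1..length u} \<Longrightarrow> word_comp u i [0] = u"
  by (erule split_at) (simp add: word_comp_split)

lemma word_comp_unit_left: "word_comp [0] 1 u = u"
  by (simp add: word_comp_def map_idI)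

lemma ns_set_operad_TM: "ns_set_operad (TM \<gamma>)"
proof -
  have TM: "elems (TM \<gamma>) = {w. w \<noteq> [] \<and> set w \<subseteq> {0..\<gamma>}}" "arity (TM \<gamma>) = length"
      "pcomp (TM \<gamma>) = word_comp" "opunit (TM \<gamma>) = [0]"
    by (simp_all add: TM_def)
  have ne: "word_comp u i v \<noteq> []" if "v \<noteq> []" for u i v
    using that by (simp add: word_comp_def)
  show ?thesis
  proof (unfold_locales, unfold TM)
    fix u v :: "nat list" and i
    assume "u \<in> {w. w \<noteq> [] \<and> set w \<subseteq> {0..\<gamma>}}" "v \<in> {w. w \<noteq> [] \<and> set w \<subseteq> {0..\<gamma>}}"
      and "i \<in> {1..length u}"
    then show "word_comp u i v \<in> {w. w \<noteq> [] \<and> set w \<subseteq> {0..\<gamma>}}"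
      using set_word_comp ne by blast
  next
    fix u v :: "nat list" and i
    assume "i \<in> {1..length u}"
    then show "length (word_comp u i v) = length u + length v - 1"
      by (simp add: length_word_comp)
  qed ((rule word_comp_seq word_comp_par word_comp_unit_right word_comp_unit_left; assumption)
      | (simp add: Suc_le_eq; fail))+
qed

lemma ns_set_operad_generated:
  assumes P: "ns_set_operad P" and G: "G \<subseteq> elems P"
  shows "ns_set_operad (generated_suboperad P G)"
proof -
  interpret ns_set_operad P by (rule P)
  let ?Q = "generated_suboperad P G"
  have Q: "elems ?Q = \<Inter>{H. is_suboperad P H \<and> G \<subseteq> H}" "arity ?Q = arity P"
      "pcomp ?Q = pcomp P" "opunit ?Q = opunit P"
    by (simp_all add: generated_suboperad_def)
  have "is_suboperad P (elems P)"
    unfolding is_suboperad_def using unit_closed pcomp_closed by blast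
  then have sub: "x \<in> elems P" if "x \<in> elems ?Q" for x
    using that G unfolding Q by blast
  show ?thesis
  proof (unfold_locales, unfold Q(2-4))
    show "opunit P \<in> elems ?Q"
      by (auto simp: Q is_suboperad_def)
  next
    fix x y i
    assume "x \<in> elems ?Q" "y \<in> elems ?Q" "i \<in> {1..arity P x}"
    then show "pcomp P x i y \<in> elems ?Q"
      unfolding Q is_suboperad_def by blast
  qed (intro arity_pos arity_unit arity_pcomp pcomp_seq pcomp_par unit_left unit_right sub; assumption)+
qed

lemma ns_set_operad_Trias: "ns_set_operad (Trias \<gamma>)"
  unfolding Trias_def
  by (intro ns_set_operad_generated ns_set_operad_TM) (auto simp: Trias_gens_def TM_def)

end

theory Submission
  imports Defs
begin

text \<open>
  Words containing \<open>0\<close> are closed under composition, because substituting into the letter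
  \<open>0\<close> leaves the inserted word unchanged. Conversely, a word \<open>p 0 q\<close> grows out of the
  unit by repeatedly substituting \<open>0 a\<close> or \<open>a 0\<close> into the distinguished \<open>0\<close>, which
  inserts the letter \<open>a\<close> directly after or before it.
\<close>

text \<open>If the replaced letter is \<open>0\<close>, then \<open>v\<close> is copied unchanged,
  with its \<open>0\<close>; otherwise a \<open>0\<close> of \<open>u\<close> lies in
  \<open>p\<close> or \<open>q\<close> and survives.\<close>

lemma zero_in_word_comp:
  assumes "i \<in> {1..length u}" "0 \<in> set u" "0 \<in> set v"
  shows "0 \<in> set (word_comp u i v)"
proof -
  obtain p a q where u: "u = p @ a # q" "i = Suc (length p)"
    using assms(1) by (rule split_at)
  show ?thesis
    using assms(2,3) unfolding u word_comp_split by force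
qed

lemma is_suboperad_words_with_zero:
  "is_suboperad (TM \<gamma>) {w. set w \<subseteq> {0..\<gamma>} \<and> 0 \<in> set w}"
proof -
  have "word_comp u i v \<in> {w. set w \<subseteq> {0..\<gamma>} \<and> 0 \<in> set w}"
    if "u \<in> {w. set w \<subseteq> {0..\<gamma>} \<and> 0 \<in> set w}"
      "v \<in> {w. set w \<subseteq> {0..\<gamma>} \<and> 0 \<in> set w}" "i \<in> {1..length u}" for u v i
    using that set_word_comp zero_in_word_comp by simp
  then show ?thesis
    by (auto simp: is_suboperad_def TM_def)
qed

lemma word_with_zero_in_suboperad:
  assumes H: "is_suboperad (TM \<gamma>) H" and gens: "Trias_gens \<gamma> \<subseteq> H"
    and w: "set w \<subseteq> {0..\<gamma>}" "0 \<in> set w"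
  shows "w \<in> H"
proof -
  \<comment> \<open>\<open>max 0\<close> is the identity, so composing at a \<open>0\<close> is
    plain replacement of that letter.\<close>
  have subst: "p @ v @ q \<in> H" if "p @ 0 # q \<in> H" "v \<in> H" for p q v
  proof -
    have "word_comp (p @ 0 # q) (Suc (length p)) v \<in> H"
      using H that by (fastforce simp: is_suboperad_def TM_def)
    then show ?thesis
      by (simp add: word_comp_split map_idI)
  qed
  \<comment> \<open>For \<open>a = 0\<close> both words are the generator
    \<open>[0, 0]\<close>.\<close>
  have pairs: "[0, a] \<in> H" "[a, 0] \<in> H" if "a \<le> \<gamma>" for a
    using gens that by (cases "a = 0"; auto simp: Trias_gens_def)+
  have suffix: "0 # q \<in> H" if "set q \<subseteq> {0..\<gamma>}" for q
    using that
  proof (induction q)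
    case Nil
    then show ?case using H by (simp add: is_suboperad_def TM_def)
  next
    case (Cons a q)
    then show ?case using subst[of "[]" q "[0, a]"] pairs by simp
  qed
  have "p @ 0 # q \<in> H" if "set p \<subseteq> {0..\<gamma>}" "set q \<subseteq> {0..\<gamma>}" for p q
    using that(1)
  \<comment> \<open>Replacing the \<open>0\<close> by \<open>[a, 0]\<close> puts \<open>a\<close> at
    the right end of the prefix, hence the induction from the right.\<close>
  proof (induction p rule: rev_induct)
    case Nil
    then show ?case using suffix that(2) by simp
  next
    case (snoc a p)
    then show ?case using subst[of p q "[a, 0]"] pairs by simp
  qed
  moreover obtain p q where "w = p @ 0 # q"
    using w(2) by (meson split_list)
  ultimately show ?thesis using w(1) by simp
qed

theorem proposition4p1p1:
  fixes \<gamma> :: nat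
  shows "elems (Trias \<gamma>) = {w :: nat list. set w \<subseteq> {0..\<gamma>} \<and> 0 \<in> set w}"
proof -
  let ?W = "{w :: nat list. set w \<subseteq> {0..\<gamma>} \<and> 0 \<in> set w}"
  have elems: "elems (Trias \<gamma>) = \<Inter>{H. is_suboperad (TM \<gamma>) H \<and> Trias_gens \<gamma> \<subseteq> H}"
    by (simp add: Trias_def generated_suboperad_def)
  have "Trias_gens \<gamma> \<subseteq> ?W"
    by (auto simp: Trias_gens_def)
  \<comment> \<open>\<open>?W\<close> is itself one of the sets being intersected.\<close>
  then have "elems (Trias \<gamma>) \<subseteq> ?W"
    unfolding elems using is_suboperad_words_with_zero by (intro Inter_lower) simp
  moreover have "?W \<subseteq> elems (Trias \<gamma>)"
    unfolding elems using word_with_zero_in_suboperad by blast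
  ultimately show ?thesis by (rule subset_antisym)
qed

end
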